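(* Let $k \ge 1$ be an integer. There is a deterministic algorithm that makes $2^{\lfloor k/2\rfloor} + 2^{\lceil k/2\rceil}$ queries and solves the Simon Problem with parameter $k$. Moreover, if the input function hides the non-zero element $s$, the algorithm finds $s$. Finally, any deterministic algorithm for the Simon Problem with parameter $k$ requires at least $q$ queries, where $q$ is the smallest positive integer such that $\binom{q}{2} \ge 2^k - 1$.
   Context: The Simon Problem with parameter $k$: we are given oracle (query) access to a function $f : \mathbb{Z}_2^k \to S$, for some set $S$ with $|S| \ge 2^k$, with the promise that either $f$ is injective, or there is an unknown non-zero element $s \in \mathbb{Z}_2^k$ such that for all $x, y \in \mathbb{Z}_2^k$, $f(x) = f(y)$ if and only if $x + y \in \{0, s\}$ (in the latter case $f$ is said to hide $s$). The task is to determine which of the two cases holds. A query is one evaluation of $f$ at a chosen point; the query complexity of an algorithm is the (worst-case) number of queries it makes. *)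

theory Defs
  imports
    "HOL-Library.Z2"
    "HOL-Library.Extended_Nat"
    "HOL-Analysis.Finite_Cartesian_Product"
begin

text \<open>
  A deterministic (adaptive) query algorithm is a decision tree: the next query, or the final
  answer, is an arbitrary function of the oracle's replies so far. Computation between queries is
  free and unrestricted. Every branch of a tree is finite, so a run always ends; the number of
  queries need not be bounded over all oracles, since a node may have infinitely many children.
\<close>

datatype ('x, 'y, 'r) query_algorithm =
    Answer 'r
  | Query 'x "'y \<Rightarrow> ('x, 'y, 'r) query_algorithm"

primrec run :: "('x, 'y, 'r) query_algorithm \<Rightarrow> ('x \<Rightarrow> 'y) \<Rightarrow> 'r" where
  "run (Answer r) f = r"
| "run (Query x next) f = run (next (f x)) f"

text \<open>Repeated queries of the same point are counted each time.\<close>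

primrec num_queries :: "('x, 'y, 'r) query_algorithm \<Rightarrow> ('x \<Rightarrow> 'y) \<Rightarrow> nat" where
  "num_queries (Answer r) f = 0"
| "num_queries (Query x next) f = Suc (num_queries (next (f x)) f)"

text \<open>The worst case is taken over the set \<open>P\<close> of oracles satisfying the promise.\<close>

definition query_complexity :: "('x \<Rightarrow> 'y) set \<Rightarrow> ('x, 'y, 'r) query_algorithm \<Rightarrow> enat" where
  "query_complexity P A = (SUP f\<in>P. enat (num_queries A f))"

text \<open>
  The group \<open>\<int>\<^sub>2\<^sup>k\<close> is the type \<open>bit ^ 'n\<close> with \<open>k = CARD('n)\<close>.
\<close>

definition hides :: "(bit ^ 'n \<Rightarrow> 'a) \<Rightarrow> bit ^ 'n \<Rightarrow> bool" where
  "hides f s \<longleftrightarrow> s \<noteq> 0 \<and> (\<forall>x y. f x = f y \<longleftrightarrow> x + y \<in> {0, s})"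

definition simon_inputs :: "'a set \<Rightarrow> (bit ^ 'n \<Rightarrow> 'a) set" where
  "simon_inputs S = {f. range f \<subseteq> S \<and> (inj f \<or> (\<exists>s. hides f s))}"

text \<open>
  The answer \<open>None\<close> declares the input injective, and any answer \<open>Some t\<close> declares that it hides some
  non-zero element. Solving the problem only requires the correct case: \<open>t\<close> is unconstrained here,
  so an algorithm that merely decides between the two cases may return an arbitrary \<open>t\<close>.
\<close>

definition solves_simon ::
    "'a set \<Rightarrow> (bit ^ 'n, 'a, (bit ^ 'n) option) query_algorithm \<Rightarrow> bool" where
  "solves_simon S A \<longleftrightarrow> (\<forall>f\<in>simon_inputs S. run A f = None \<longleftrightarrow> inj f)"

definition finds_hidden ::
    "'a set \<Rightarrow> (bit ^ 'n, 'a, (bit ^ 'n) option) query_algorithm \<Rightarrow> bool" where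
  "finds_hidden S A \<longleftrightarrow> (\<forall>f\<in>simon_inputs S. \<forall>s. hides f s \<longrightarrow> run A f = Some s)"

end

theory Submission
  imports Defs
begin

text \<open>
  Upper bound: split the coordinates into two halves and query all vectors supported on either
  half. Every \<open>s\<close> is a sum \<open>x + y\<close> of one vector of each kind, and \<open>x + y = s \<noteq> 0\<close> is equivalent to
  a collision \<open>f x = f y\<close>, so the replies reveal \<open>s\<close>.

  Lower bound: run the algorithm on an injective oracle \<open>f\<close>. If the set \<open>Q\<close> of queried points is
  small, then some \<open>s \<noteq> 0\<close> is not a sum of two distinct points of \<open>Q\<close>. So each coset of \<open>{0, s}\<close> has a
  representative that is the only possible point of \<open>Q\<close> in it, and composing \<open>f\<close> with the choice of
  representatives gives an oracle hiding \<open>s\<close> that agrees with \<open>f\<close> on \<open>Q\<close>.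
\<close>

section \<open>Non-adaptive algorithms\<close>

text \<open>The function \<open>m\<close> records the replies received so far; its other values are junk.\<close>

primrec query_all :: "'x list \<Rightarrow> ('x \<Rightarrow> 'y) \<Rightarrow> (('x \<Rightarrow> 'y) \<Rightarrow> 'r) \<Rightarrow> ('x, 'y, 'r) query_algorithm" where
  "query_all [] m d = Answer (d m)"
| "query_all (x # xs) m d = Query x (\<lambda>y. query_all xs (m(x := y)) d)"

lemma num_queries_query_all [simp]: "num_queries (query_all xs m d) f = length xs"
  by (induction xs arbitrary: m) auto

lemma run_query_all: "run (query_all xs m d) f = d (\<lambda>x. if x \<in> set xs then f x else m x)"
proof (induction xs arbitrary: m)
  case (Cons a xs)
  have "(\<lambda>x. if x \<in> set xs then f x else (m(a := f a)) x)
      = (\<lambda>x. if x \<in> set (a # xs) then f x else m x)"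
    by auto
  then show ?case
    using Cons.IH[of "m(a := f a)"] by (simp only: query_all.simps run.simps)
qed simp

section \<open>The queried points\<close>

primrec queried :: "('x, 'y, 'r) query_algorithm \<Rightarrow> ('x \<Rightarrow> 'y) \<Rightarrow> 'x set" where
  "queried (Answer r) f = {}"
| "queried (Query x next) f = insert x (queried (next (f x)) f)"

lemma finite_queried: "finite (queried A f)"
  by (induction A) auto

lemma card_queried_le: "card (queried A f) \<le> num_queries A f"
proof (induction A)
  case (Query x nxt)
  have "card (queried (nxt (f x)) f) \<le> num_queries (nxt (f x)) f"
    by (rule Query.IH) simp
  then show ?case
    by (simp add: card_insert_if finite_queried)
qed simp

text \<open>The points asked depend on the replies, but an oracle with the same replies along the
  branch taken by \<open>f\<close> never leaves that branch.\<close>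

lemma run_cong_queried: "(\<And>x. x \<in> queried A f \<Longrightarrow> g x = f x) \<Longrightarrow> run A g = run A f"
proof (induction A)
  case (Query x nxt)
  have "run (nxt (f x)) g = run (nxt (f x)) f"
    by (rule Query.IH) (use Query.prems in auto)
  then show ?case
    using Query.prems by simp
qed simp

section \<open>Binary vectors\<close>

lemma bit_vec_add_self [simp]: "x + x = (0 :: bit ^ 'n)"
  by (simp add: vec_eq_iff)

lemma bit_vec_add_self_left [simp]: "x + (x + y) = (y :: bit ^ 'n)"
  by (simp flip: add.assoc)

lemma bit_vec_add_eq_iff: "x + y = z \<longleftrightarrow> y = x + (z :: bit ^ 'n)"
  by auto

text \<open>Such vectors are the indicator functions of subsets of \<open>I\<close>. This counts the
  queries of the algorithm and, for \<open>I = UNIV\<close>, the whole group.\<close>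

lemma card_bit_vec_supported:
  "card {x :: bit ^ 'n::finite. \<forall>i. i \<notin> I \<longrightarrow> x $ i = 0} = 2 ^ card I" (is "card ?V = _")
proof -
  have "bij_betw (\<lambda>J. \<chi> i. of_bool (i \<in> J)) (Pow I) ?V"
    by (rule bij_betw_byWitness[where f' = "\<lambda>x. {i. x $ i = 1}"])
       (auto simp: vec_eq_iff)
  then show ?thesis
    by (simp add: bij_betw_same_card[symmetric] card_Pow)
qed

lemma card_UNIV_bit_vec: "card (UNIV :: (bit ^ 'n::finite) set) = 2 ^ CARD('n)"
  using card_bit_vec_supported[of "UNIV :: 'n set"] by (simp del: CARD_vec)

lemma finite_UNIV_bit_vec: "finite (UNIV :: (bit ^ 'n::finite) set)"
  by (rule card_ge_0_finite) (simp add: card_UNIV_bit_vec del: CARD_vec)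

text \<open>By commutativity a sum depends only on the unordered pair, and there are
  \<open>card Q choose 2\<close> of those.\<close>

lemma card_pair_sums_le:
  fixes Q :: "'b::comm_monoid_add set"
  assumes "finite Q"
  shows "finite {x + y | x y. x \<in> Q \<and> y \<in> Q \<and> x \<noteq> y}" (is "finite ?D")
    and "card {x + y | x y. x \<in> Q \<and> y \<in> Q \<and> x \<noteq> y} \<le> card Q choose 2"
proof -
  let ?P = "{T. T \<subseteq> Q \<and> card T = 2}"
  have sub: "?D \<subseteq> sum (\<lambda>x. x) ` ?P"
  proof
    fix z assume "z \<in> ?D"
    then obtain x y where "z = x + y" "x \<in> Q" "y \<in> Q" "x \<noteq> y"
      by blast
    then show "z \<in> sum (\<lambda>x. x) ` ?P"
      by (intro image_eqI[of _ _ "{x, y}"]) auto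
  qed
  have fin: "finite ?P"
    using assms by simp
  show "finite ?D"
    using sub fin by (meson finite_imageI finite_subset)
  have "card ?D \<le> card ?P"
    using sub fin by (meson card_image_le card_mono finite_imageI le_trans)
  also have "\<dots> = card Q choose 2"
    by (rule n_subsets[OF assms])
  finally show "card ?D \<le> card Q choose 2" .
qed

lemma exists_non_pair_sum:
  fixes Q :: "(bit ^ 'n::finite) set"
  assumes "finite Q" "card Q choose 2 < 2 ^ CARD('n) - 1"
  obtains s where "s \<noteq> 0" "\<And>x y. x \<in> Q \<Longrightarrow> y \<in> Q \<Longrightarrow> x + y \<noteq> s"
proof -
  let ?D = "{x + y | x y. x \<in> Q \<and> y \<in> Q \<and> x \<noteq> y}"
  have "card ?D < card (UNIV - {0 :: bit ^ 'n})"
    using card_pair_sums_le(2)[OF assms(1)] assms(2) finite_UNIV_bit_vec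
    by (simp add: card_Diff_singleton card_UNIV_bit_vec del: CARD_vec)
  then have "\<not> UNIV - {0} \<subseteq> ?D"
    using card_mono[OF card_pair_sums_le(1)[OF assms(1)]] by (meson not_le)
  then obtain s where s: "s \<noteq> 0" "s \<notin> ?D"
    by blast
  \<comment> \<open>The set \<open>?D\<close> omits the pairs with \<open>x = y\<close>, but these
    sum to 0, which differs from \<open>s\<close>.\<close>
  have "x + y \<noteq> s" if "x \<in> Q" "y \<in> Q" for x y
    using s that by (cases "x = y") auto
  with s(1) that show ?thesis
    by blast
qed

section \<open>Upper and lower bounds\<close>

lemma hides_not_inj: "hides f s \<Longrightarrow> \<not> inj f"
  unfolding hides_def by (metis add_0 injD insertCI)

text \<open>Provides the run that the lower bound analyses, and shows that the supremum in
  \<open>query_complexity\<close> is over a nonempty set.\<close>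

lemma exists_inj_simon_input:
  fixes S :: "'a set"
  assumes "finite S \<Longrightarrow> 2 ^ CARD('n::finite) \<le> card S"
  obtains f :: "bit ^ 'n \<Rightarrow> 'a" where "inj f" "f \<in> simon_inputs S"
proof -
  obtain T where T: "T \<subseteq> S" "finite T" "card T = 2 ^ CARD('n)"
    using assms by (metis infinite_arbitrarily_large obtain_subset_with_card_n)
  then obtain f :: "bit ^ 'n \<Rightarrow> 'a" where "bij_betw f UNIV T"
    using finite_same_card_bij[OF finite_UNIV_bit_vec] by (metis card_UNIV_bit_vec)
  then show ?thesis
    using that[of f] T(1) by (auto simp: bij_betw_def simon_inputs_def)
qed

lemma exists_hiding_oracle:
  fixes f :: "bit ^ 'n \<Rightarrow> 'a" and s :: "bit ^ 'n"
  assumes "inj f" "s \<noteq> 0" and Q: "\<And>x y. x \<in> Q \<Longrightarrow> y \<in> Q \<Longrightarrow> x + y \<noteq> s"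
  obtains h where "hides h s" "range h \<subseteq> range f" "\<And>x. x \<in> Q \<Longrightarrow> h x = f x"
proof -
  \<comment> \<open>Exactly one of \<open>x\<close> and \<open>x + s\<close> vanishes at
    \<open>i\<close>, so this coordinate selects a representative of any coset that misses
    \<open>Q\<close>. Otherwise the point of \<open>Q\<close> is taken, which makes
    \<open>rep\<close> the identity on \<open>Q\<close>.\<close>
  obtain i where i: "s $ i = 1"
    using assms(2) by (auto simp: vec_eq_iff)
  define rep where "rep x = (if x \<in> Q then x else if x + s \<in> Q then x + s
      else if x $ i = 0 then x else x + s)" for x
  have notboth: "\<not> (x \<in> Q \<and> x + s \<in> Q)" for x
    using Q[of x "x + s"] by auto
  have shift: "rep (x + s) = rep x" for x
    using notboth[of x] i by (auto simp: rep_def add.assoc)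
  have cases: "rep x = x \<or> rep x = x + s" for x
    by (auto simp: rep_def)
  have "rep x = rep y \<longleftrightarrow> x + y \<in> {0, s}" for x y
  proof
    assume "rep x = rep y"
    then have "x + y = 0 \<or> x + y = s"
      using cases[of x] cases[of y] by (auto simp: bit_vec_add_eq_iff ac_simps)
    then show "x + y \<in> {0, s}" by simp
  next
    assume "x + y \<in> {0, s}"
    then have "y = x \<or> y = x + s"
      by (auto simp: bit_vec_add_eq_iff)
    then show "rep x = rep y"
      using shift by auto
  qed
  then have "hides (f \<circ> rep) s"
    using assms(1,2) by (simp add: hides_def inj_eq)
  moreover have "(f \<circ> rep) x = f x" if "x \<in> Q" for x
    using that by (simp add: rep_def)
  ultimately show ?thesis
    using that[of "f \<circ> rep"] by auto
qed

text \<open>The bound holds on every injective input: with fewer queries, a hiding oracle would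
  receive the same answer as \<open>f\<close>.\<close>

lemma simon_lower_bound:
  fixes f :: "bit ^ 'n::finite \<Rightarrow> 'a"
  assumes "solves_simon S A" "inj f" "f \<in> simon_inputs S"
  shows "2 ^ CARD('n) - 1 \<le> num_queries A f choose 2"
proof (rule ccontr)
  assume "\<not> ?thesis"
  moreover have "card (queried A f) choose 2 \<le> num_queries A f choose 2"
    by (rule binomial_right_mono[OF card_queried_le])
  ultimately have "card (queried A f) choose 2 < 2 ^ CARD('n) - 1"
    by linarith
  then obtain s where s: "s \<noteq> 0"
      "\<And>x y. x \<in> queried A f \<Longrightarrow> y \<in> queried A f \<Longrightarrow> x + y \<noteq> s"
    by (rule exists_non_pair_sum[OF finite_queried]) blast
  obtain h where h: "hides h s" "range h \<subseteq> range f" "\<And>x. x \<in> queried A f \<Longrightarrow> h x = f x"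
    using exists_hiding_oracle[OF assms(2) s] by metis
  have "h \<in> simon_inputs S"
    using h(1,2) assms(3) unfolding simon_inputs_def by blast
  moreover have "run A h = run A f"
    by (rule run_cong_queried) (fact h(3))
  ultimately show False
    using assms hides_not_inj[OF h(1)] unfolding solves_simon_def by metis
qed

lemma simon_algorithm:
  fixes I :: "'n::finite set"
  obtains A :: "(bit ^ 'n, 'a, (bit ^ 'n) option) query_algorithm"
  where "\<And>f. num_queries A f = 2 ^ card I + 2 ^ card (- I)" "solves_simon S A" "finds_hidden S A"
proof -
  define X where "X = {x :: bit ^ 'n. \<forall>i. i \<notin> I \<longrightarrow> x $ i = 0}"
  define Y where "Y = {x :: bit ^ 'n. \<forall>i. i \<notin> - I \<longrightarrow> x $ i = 0}"
  \<comment> \<open>The condition \<open>t \<noteq> 0\<close> discards the trivial collision at 0,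
    which lies in both \<open>X\<close> and \<open>Y\<close>. As 0 is queried twice, the number of
    queries is exactly the sum of the two sizes.\<close>
  define found :: "(bit ^ 'n \<Rightarrow> 'a) \<Rightarrow> bit ^ 'n \<Rightarrow> bool"
    where "found g t \<longleftrightarrow> t \<noteq> 0 \<and> (\<exists>x\<in>X. \<exists>y\<in>Y. t = x + y \<and> g x = g y)" for g t
  define d where "d g = (if \<exists>t. found g t then Some (SOME t. found g t) else None)" for g
  obtain xs ys where xs: "set xs = X" "distinct xs" and ys: "set ys = Y" "distinct ys"
    using finite_distinct_list finite_subset[OF subset_UNIV finite_UNIV_bit_vec] by metis
  define A where "A = query_all (xs @ ys) (\<lambda>_. undefined) d"
  have run: "run A f = d f" for f
  proof -
    \<comment> \<open>\<open>found\<close> evaluates its oracle only on \<open>X\<close> and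
      \<open>Y\<close>, so the value \<open>undefined\<close> elsewhere is harmless.\<close>
    have "found (\<lambda>x. if x \<in> set (xs @ ys) then f x else undefined) = found f"
      by (simp add: found_def fun_eq_iff xs ys)
    then show ?thesis
      by (simp add: A_def run_query_all d_def)
  qed
  have num: "num_queries A f = 2 ^ card I + 2 ^ card (- I)" for f
    using distinct_card[OF xs(2)] distinct_card[OF ys(2)]
    by (simp add: A_def xs ys X_def Y_def card_bit_vec_supported del: Compl_iff)
  have hidden: "run A f = Some s" if "hides f s" for f s
  proof -
    define x :: "bit ^ 'n" where "x = (\<chi> i. if i \<in> I then s $ i else 0)"
    define y :: "bit ^ 'n" where "y = (\<chi> i. if i \<in> I then 0 else s $ i)"
    have "x \<in> X" "y \<in> Y" "s = x + y"
      by (auto simp: x_def y_def X_def Y_def vec_eq_iff)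
    then have "found f s"
      using that by (auto simp: found_def hides_def)
    \<comment> \<open>A collision forces \<open>t\<close> into \<open>{0, s}\<close>, so
      \<open>SOME\<close> has no choice but \<open>s\<close>.\<close>
    moreover have "t = s" if "found f t" for t
      using that \<open>hides f s\<close> by (auto simp: found_def hides_def)
    ultimately have "\<exists>t. found f t" "(SOME t. found f t) = s"
      by blast+
    then show ?thesis
      by (simp add: run d_def)
  qed
  have "run A f = None" if "inj f" for f
    using that by (auto simp: run d_def found_def dest: injD)
  then have "solves_simon S A"
    using hidden hides_not_inj by (fastforce simp: solves_simon_def simon_inputs_def)
  moreover have "finds_hidden S A"
    using hidden by (simp add: finds_hidden_def)
  ultimately show ?thesis
    using num that by blast
qed

theorem theorem1:
  fixes S :: "'a set" and k :: nat
  assumes k: "k = CARD('n::finite)"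
    and S: "finite S \<Longrightarrow> 2 ^ k \<le> card S"
  shows "(\<exists>A :: (bit ^ 'n, 'a, (bit ^ 'n) option) query_algorithm.
            query_complexity (simon_inputs S) A
              = enat (2 ^ nat \<lfloor>real k / 2\<rfloor> + 2 ^ nat \<lceil>real k / 2\<rceil>) \<and>
            solves_simon S A \<and>
            finds_hidden S A) \<and>
         (\<forall>A :: (bit ^ 'n, 'a, (bit ^ 'n) option) query_algorithm.
            solves_simon S A \<longrightarrow>
            enat (LEAST q. 0 < q \<and> 2 ^ k - 1 \<le> q choose 2)
              \<le> query_complexity (simon_inputs S) A)"
proof (intro conjI allI impI)
  obtain f :: "bit ^ 'n \<Rightarrow> 'a" where f: "inj f" "f \<in> simon_inputs S"
    using exists_inj_simon_input S unfolding k by blast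
  have floor: "nat \<lfloor>real k / 2\<rfloor> = k div 2" and ceil: "nat \<lceil>real k / 2\<rceil> = k - k div 2"
    by linarith+
  obtain I :: "'n set" where I: "card I = k div 2"
    using obtain_subset_with_card_n[of "k div 2" "UNIV :: 'n set"] k by auto
  then have I': "card (- I) = k - k div 2"
    unfolding Compl_eq_Diff_UNIV k by (subst card_Diff_subset) auto
  obtain A :: "(bit ^ 'n, 'a, (bit ^ 'n) option) query_algorithm"
    where A: "\<And>f. num_queries A f = 2 ^ card I + 2 ^ card (- I)" "solves_simon S A" "finds_hidden S A"
    by (rule simon_algorithm[of I S]) blast
  \<comment> \<open>Over an empty set of oracles the supremum would be 0 instead of the constant
    number of queries.\<close>
  have "simon_inputs S \<noteq> ({} :: (bit ^ 'n \<Rightarrow> 'a) set)"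
    using f by blast
  then have "query_complexity (simon_inputs S) A
      = enat (2 ^ nat \<lfloor>real k / 2\<rfloor> + 2 ^ nat \<lceil>real k / 2\<rceil>)"
    unfolding query_complexity_def A(1) I I' floor ceil by simp
  with A show "\<exists>A :: (bit ^ 'n, 'a, (bit ^ 'n) option) query_algorithm.
            query_complexity (simon_inputs S) A
              = enat (2 ^ nat \<lfloor>real k / 2\<rfloor> + 2 ^ nat \<lceil>real k / 2\<rceil>) \<and>
            solves_simon S A \<and>
            finds_hidden S A"
    by blast
  fix A :: "(bit ^ 'n, 'a, (bit ^ 'n) option) query_algorithm"
  assume A: "solves_simon S A"
  have le: "2 ^ k - 1 \<le> num_queries A f choose 2"
    unfolding k by (rule simon_lower_bound[OF A f])
  \<comment> \<open>Since \<open>k\<close> is a cardinality of a nonempty type,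
    \<open>2 ^ k - 1\<close> is positive. This rules out zero queries, as the condition
    \<open>0 < q\<close> under \<open>LEAST\<close> demands.\<close>
  have "(2::nat) ^ 1 \<le> 2 ^ k"
    unfolding k by (intro power_increasing) (auto simp: Suc_le_eq)
  with le have "0 < num_queries A f"
    by (cases "num_queries A f") (auto simp: binomial_eq_0)
  with le have "(LEAST q. 0 < q \<and> 2 ^ k - 1 \<le> q choose 2) \<le> num_queries A f"
    by (intro Least_le) simp
  also have "enat (num_queries A f) \<le> query_complexity (simon_inputs S) A"
    unfolding query_complexity_def by (rule SUP_upper[OF f(2)])
  finally show "enat (LEAST q. 0 < q \<and> 2 ^ k - 1 \<le> q choose 2)
      \<le> query_complexity (simon_inputs S) A"
    by simp
qed

end
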